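(* In the random graph model described in the context, let $b\in(10h_M-6h_1+3M\epsilon_{max}+2,\infty)$ and let $\mathcal{A}_i:=\{L(t_i)\le b\}$ for $i\ge1$. Then almost surely infinitely many of the events $\mathcal{A}_1,\mathcal{A}_2,\dots$ occur.
   Context: **Model.** Fix an integer $M\ge 2$, integers $0<h_1<h_2<\dots<h_M$, numbers $p_{\Theta,1},\dots,p_{\Theta,M}>0$ with $\sum_k p_{\Theta,k}=1$, a finite nonempty set $I_\epsilon$ of positive integers with minimum $\epsilon_{min}$ and maximum $\epsilon_{max}$, and numbers $p_{\epsilon,j}>0$ ($j\in I_\epsilon$) with $\sum_j p_{\epsilon,j}=1$. Put $t_n:=n$; times and integers are identified. Vertices are labelled $0,1,2,\dots$; vertex $0$ is present at time $t_0$, and vertex $n\ge1$ arrives at time $t_n$. A pair $(i,j)$ denotes a directed edge from $i$ to $j$ ($j$ is then a parent of $i$). Each vertex $n\ge 1$ carries random variables $\Theta_n\in\{h_1,\dots,h_M\}$ (its proof-of-work, POW, duration), $\epsilon_n\in I_\epsilon$ (lag), and $X_n,Y_n$ (its two, possibly equal, parents). The directed graphs $\mathcal{G}(t_n)=(\mathcal{V}(t_n),\mathcal{E}(t_n))$ are defined by $\mathcal{V}(t_0)=\{0\}$, $\mathcal{E}(t_0)=\emptyset$, $$\mathcal{V}(t_{n+1})=\mathcal{V}(t_n)\cup\{k\ge1: t_k+\Theta_k=t_n\},\qquad \mathcal{E}(t_{n+1})=\mathcal{E}(t_n)\cup\{(k,X_k),(k,Y_k): k\ge 1,\ t_k+\Theta_k=t_n\},$$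 and $\mathcal{G}(t_n):=\mathcal{G}(t_0)$ for $n<0$. The set of tips is $\mathcal{L}(t_n):=\{v\in\mathcal{V}(t_n): (i,v)\notin\mathcal{E}(t_n)\text{ for all }i\}$, and $L(t_n):=|\mathcal{L}(t_n)|$. Let $\Sigma_n$ be the $\sigma$-algebra generated by $\Theta_m,\epsilon_m,X_m,Y_m$, $1\le m\le n$. The law is determined by $$\mathbb{P}(\Theta_n=h_k,\epsilon_n=j,X_n=v,Y_n=v'\mid\Sigma_{n-1})=\frac{p_{\Theta,k}\,p_{\epsilon,j}}{L(t_n-j)^2}\,1_{\{v,v'\in\mathcal{L}(t_n-j)\}}$$ for $n\ge1$, $1\le k\le M$, $j\in I_\epsilon$ (so the two parents are chosen uniformly with replacement among the tips at time $t_n-\epsilon_n$). *)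

theory Defs
  imports "HOL-Probability.Probability"
begin

section \<open>The graphs along one sample path\<close>

text \<open>
  Vertices are natural numbers, times are integers, and \<open>(i, j)\<close> is an edge from \<open>i\<close> to its
  parent \<open>j\<close>. The functions \<open>\<theta>\<close>, \<open>x\<close>, \<open>y\<close> give the POW durations and the two parents of
  the vertices on one sample path; their values at the vertex \<open>0\<close> are irrelevant.
\<close>

primrec vertices_nat :: "(nat \<Rightarrow> nat) \<Rightarrow> nat \<Rightarrow> nat set" where
  "vertices_nat \<theta> 0 = {0}"
| "vertices_nat \<theta> (Suc n) = vertices_nat \<theta> n \<union> {k. k \<ge> 1 \<and> k + \<theta> k = n}"

primrec edges_nat ::
  "(nat \<Rightarrow> nat) \<Rightarrow> (nat \<Rightarrow> nat) \<Rightarrow> (nat \<Rightarrow> nat) \<Rightarrow> nat \<Rightarrow> (nat \<times> nat) set" where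
  "edges_nat \<theta> x y 0 = {}"
| "edges_nat \<theta> x y (Suc n) =
     edges_nat \<theta> x y n \<union> (\<Union>k\<in>{k. k \<ge> 1 \<and> k + \<theta> k = n}. {(k, x k), (k, y k)})"

text \<open>Since \<open>nat t = 0\<close> for \<open>t < 0\<close>, the graph at a negative time is the graph at time \<open>0\<close>.\<close>

definition vertices :: "(nat \<Rightarrow> nat) \<Rightarrow> int \<Rightarrow> nat set" where
  "vertices \<theta> t = vertices_nat \<theta> (nat t)"

definition edges ::
  "(nat \<Rightarrow> nat) \<Rightarrow> (nat \<Rightarrow> nat) \<Rightarrow> (nat \<Rightarrow> nat) \<Rightarrow> int \<Rightarrow> (nat \<times> nat) set" where
  "edges \<theta> x y t = edges_nat \<theta> x y (nat t)"

definition tips :: "(nat \<Rightarrow> nat) \<Rightarrow> (nat \<Rightarrow> nat) \<Rightarrow> (nat \<Rightarrow> nat) \<Rightarrow> int \<Rightarrow> nat set" where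
  "tips \<theta> x y t = {v \<in> vertices \<theta> t. \<forall>i. (i, v) \<notin> edges \<theta> x y t}"

definition num_tips :: "(nat \<Rightarrow> nat) \<Rightarrow> (nat \<Rightarrow> nat) \<Rightarrow> (nat \<Rightarrow> nat) \<Rightarrow> int \<Rightarrow> nat" where
  "num_tips \<theta> x y t = card (tips \<theta> x y t)"

lemma finite_vertices_nat: "finite (vertices_nat \<theta> n)"
proof (induction n)
  case (Suc n)
  have "finite {k. k \<ge> 1 \<and> k + \<theta> k = n}"
    by (rule finite_subset[of _ "{..n}"]) auto
  with Suc show ?case by simp
qed simp

lemma finite_tips: "finite (tips \<theta> x y t)"
  unfolding tips_def vertices_def using finite_vertices_nat by simp

section \<open>The random model\<close>

text \<open>The random variables are written as processes with the vertex as first argument.\<close>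

definition history ::
  "'a measure \<Rightarrow> (nat \<Rightarrow> 'a \<Rightarrow> nat) \<Rightarrow> (nat \<Rightarrow> 'a \<Rightarrow> nat) \<Rightarrow> (nat \<Rightarrow> 'a \<Rightarrow> nat) \<Rightarrow>
   (nat \<Rightarrow> 'a \<Rightarrow> nat) \<Rightarrow> nat \<Rightarrow> 'a measure" where
  "history P \<Theta> lag X Y n =
     sigma (space P)
       {Z -` B \<inter> space P | Z B. \<exists>m\<in>{1..n}. Z \<in> {\<Theta> m, lag m, X m, Y m}}"

definition tips_at ::
  "(nat \<Rightarrow> 'a \<Rightarrow> nat) \<Rightarrow> (nat \<Rightarrow> 'a \<Rightarrow> nat) \<Rightarrow> (nat \<Rightarrow> 'a \<Rightarrow> nat) \<Rightarrow> 'a \<Rightarrow> int \<Rightarrow> nat set" where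
  "tips_at \<Theta> X Y \<omega> t = tips (\<lambda>n. \<Theta> n \<omega>) (\<lambda>n. X n \<omega>) (\<lambda>n. Y n \<omega>) t"

definition num_tips_at ::
  "(nat \<Rightarrow> 'a \<Rightarrow> nat) \<Rightarrow> (nat \<Rightarrow> 'a \<Rightarrow> nat) \<Rightarrow> (nat \<Rightarrow> 'a \<Rightarrow> nat) \<Rightarrow> 'a \<Rightarrow> int \<Rightarrow> nat" where
  "num_tips_at \<Theta> X Y \<omega> t = num_tips (\<lambda>n. \<Theta> n \<omega>) (\<lambda>n. X n \<omega>) (\<lambda>n. Y n \<omega>) t"

text \<open>
  The parameters \<open>h\<close> and \<open>p\<Theta>\<close> are only relevant on the indices \<open>1, \<dots>, M\<close>, the parameter
  \<open>plag\<close> only on \<open>I\<close>, and the processes only at the vertices \<open>n \<ge> 1\<close>.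
\<close>

locale tip_model = prob_space P for P :: "'a measure" +
  fixes M :: nat
    and h :: "nat \<Rightarrow> nat"
    and p\<Theta> :: "nat \<Rightarrow> real"
    and I :: "nat set"
    and plag :: "nat \<Rightarrow> real"
    and \<Theta> lag X Y :: "nat \<Rightarrow> 'a \<Rightarrow> nat"
  assumes M_ge_2: "M \<ge> 2"
    and h_pos: "0 < h 1"
    and h_strict_mono: "strict_mono_on {1..M} h"
    and p\<Theta>_pos: "\<And>k. k \<in> {1..M} \<Longrightarrow> p\<Theta> k > 0"
    and p\<Theta>_sum: "(\<Sum>k=1..M. p\<Theta> k) = 1"
    and I_finite: "finite I"
    and I_nonempty: "I \<noteq> {}"
    and I_pos: "\<And>j. j \<in> I \<Longrightarrow> j > 0"
    and plag_pos: "\<And>j. j \<in> I \<Longrightarrow> plag j > 0"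
    and plag_sum: "(\<Sum>j\<in>I. plag j) = 1"
    and measurable_\<Theta>: "\<And>n. n \<ge> 1 \<Longrightarrow> \<Theta> n \<in> measurable P (count_space UNIV)"
    and measurable_lag: "\<And>n. n \<ge> 1 \<Longrightarrow> lag n \<in> measurable P (count_space UNIV)"
    and measurable_X: "\<And>n. n \<ge> 1 \<Longrightarrow> X n \<in> measurable P (count_space UNIV)"
    and measurable_Y: "\<And>n. n \<ge> 1 \<Longrightarrow> Y n \<in> measurable P (count_space UNIV)"
    and \<Theta>_range: "\<And>n \<omega>. n \<ge> 1 \<Longrightarrow> \<omega> \<in> space P \<Longrightarrow> \<Theta> n \<omega> \<in> h ` {1..M}"
    and lag_range: "\<And>n \<omega>. n \<ge> 1 \<Longrightarrow> \<omega> \<in> space P \<Longrightarrow> lag n \<omega> \<in> I"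
    and law: "\<And>n k j v v'. n \<ge> 1 \<Longrightarrow> k \<in> {1..M} \<Longrightarrow> j \<in> I \<Longrightarrow>
      AE \<omega> in P.
        real_cond_exp P (history P \<Theta> lag X Y (n - 1))
          (indicator {\<omega> \<in> space P. \<Theta> n \<omega> = h k \<and> lag n \<omega> = j \<and> X n \<omega> = v \<and> Y n \<omega> = v'}) \<omega>
        = p\<Theta> k * plag j / (real (num_tips_at \<Theta> X Y \<omega> (int n - int j)))\<^sup>2
          * (if v \<in> tips_at \<Theta> X Y \<omega> (int n - int j) \<and> v' \<in> tips_at \<Theta> X Y \<omega> (int n - int j)
             then 1 else 0)"

end

theory Submission
  imports Defs
begin

text \<open>
  Let \<open>U n\<close> be the number of vertices below \<open>n\<close> that none of the vertices \<open>1, \<dots>, n - 1\<close> has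
  selected as a parent, whether or not the selecting vertex has finished its POW. A tip at time
  \<open>n - j\<close> that is not counted by \<open>U n\<close> was selected by one of the at most \<open>h M + j\<close> vertices that
  were pending at time \<open>n - j\<close> or arrived since then. So with \<open>c = 2 (h M + Max I)\<close> and \<open>L\<close> tips to
  choose from, vertex \<open>n\<close> selects on average at least \<open>(1 - c / L) (2 - 1 / L) \<ge> 2 - (2 c + 1) / L\<close>
  vertices counted by \<open>U n\<close>. As long as all tip counts exceed \<open>b > 2 c + 1\<close>, the expectation of
  \<open>U\<close> therefore decreases in each step by a fixed amount, which a nonnegative quantity can only do
  forever on a null event.
\<close>

section \<open>Graphs and unselected vertices along one sample path\<close>

lemma vertices_subset: "vertices \<theta> t \<subseteq> insert 0 {k. 1 \<le> k \<and> k + \<theta> k < nat t}"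
proof -
  have "vertices_nat \<theta> n \<subseteq> insert 0 {k. 1 \<le> k \<and> k + \<theta> k < n}" for n
    by (induction n) (auto simp: less_Suc_eq)
  then show ?thesis by (simp add: vertices_def)
qed

text \<open>The inequality is strict because a POW that ends at time \<open>n\<close> enters the
  graph only at time \<open>n + 1\<close>.\<close>

lemma edges_iff:
  "(k, v) \<in> edges \<theta> x y t \<longleftrightarrow> 1 \<le> k \<and> k + \<theta> k < nat t \<and> (v = x k \<or> v = y k)"
proof -
  have "(k, v) \<in> edges_nat \<theta> x y n \<longleftrightarrow> 1 \<le> k \<and> k + \<theta> k < n \<and> (v = x k \<or> v = y k)" for n
    by (induction n) (auto simp: less_Suc_eq)
  then show ?thesis by (simp add: edges_def)
qed

lemma tips_less:
  assumes "v \<in> tips \<theta> x y (int n - int j)" "1 \<le> n"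
  shows "v < n"
  using assms vertices_subset[of \<theta> "int n - int j"] by (auto simp: tips_def)

text \<open>A vertex is visible at time \<open>t\<close> only after its POW has ended, so only
  vertices that arrived before \<open>t\<close> matter. This makes the tip counts functions of the
  history.\<close>

lemma tips_cong:
  assumes "\<And>m. 1 \<le> m \<Longrightarrow> int m < t \<Longrightarrow> \<theta> m = \<theta>' m \<and> x m = x' m \<and> y m = y' m"
  shows "tips \<theta> x y t = tips \<theta>' x' y' t"
proof -
  have *: "1 \<le> m \<Longrightarrow> m < nat t \<Longrightarrow> \<theta> m = \<theta>' m \<and> x m = x' m \<and> y m = y' m" for m
    using assms[of m] by auto
  have "vertices_nat \<theta> n = vertices_nat \<theta>' n" if "n \<le> nat t" for n
    using that
  proof (induction n)
    case (Suc n)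
    then have "{k. k \<ge> 1 \<and> k + \<theta> k = n} = {k. k \<ge> 1 \<and> k + \<theta>' k = n}"
      using * by (auto simp: Suc_le_eq)
    with Suc show ?case by simp
  qed simp
  then have V: "vertices \<theta> t = vertices \<theta>' t"
    by (simp add: vertices_def)
  have "edges \<theta> x y t = edges \<theta>' x' y' t"
  proof (intro set_eqI, clarify)
    fix k v
    show "(k, v) \<in> edges \<theta> x y t \<longleftrightarrow> (k, v) \<in> edges \<theta>' x' y' t"
      using *[of k] by (cases "1 \<le> k \<and> k < nat t") (auto simp: edges_iff)
  qed
  with V show ?thesis by (simp add: tips_def)
qed

text \<open>This is the set counted by \<open>U n\<close>. A selection takes effect when the
  selecting vertex arrives, not when its POW ends, so one arrival changes the set in a way read off
  from its two parents. Selectors start at 1 since vertex 0 has no parents.\<close>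

definition unselected :: "(nat \<Rightarrow> nat) \<Rightarrow> (nat \<Rightarrow> nat) \<Rightarrow> nat \<Rightarrow> nat set" where
  "unselected x y n = {v. v < n \<and> (\<forall>m\<in>{1..<n}. x m \<noteq> v \<and> y m \<noteq> v)}"

lemma finite_unselected [simp]: "finite (unselected x y n)"
  by (simp add: unselected_def)

lemma card_unselected_le: "card (unselected x y n) \<le> n"
  using card_mono[of "{..<n}" "unselected x y n"] by (auto simp: unselected_def)

text \<open>Arrival \<open>n\<close> can add only \<open>n\<close> itself and removes the parents it
  picks. The additive form avoids truncated subtraction, and the inequality covers sample paths on
  which \<open>n\<close> picks itself.\<close>

lemma card_unselected_Suc:
  assumes "1 \<le> n"
  shows "card (unselected x y (Suc n)) + card ({x n, y n} \<inter> unselected x y n)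
    \<le> card (unselected x y n) + 1"
proof -
  let ?U = "unselected x y n"
  have "unselected x y (Suc n) \<subseteq> insert n (?U - {x n, y n})"
    using assms by (auto simp: unselected_def less_Suc_eq)
  then have "card (unselected x y (Suc n)) \<le> card (insert n (?U - {x n, y n}))"
    by (intro card_mono) auto
  also have "\<dots> \<le> card (?U - {x n, y n}) + 1"
    by (simp add: card_insert_if)
  finally have "card (unselected x y (Suc n)) \<le> card (?U - {x n, y n}) + 1" .
  moreover have "card (?U - {x n, y n}) + card ({x n, y n} \<inter> ?U) = card ?U"
    by (metis Int_commute add.commute card_Int_Diff finite_unselected)
  ultimately show ?thesis by linarith
qed

text \<open>A tip at time \<open>n - j\<close> that has been selected was selected by a vertex whose
  edges were not yet visible at that time. Such vertices lie in a short window of arrival times, and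
  each accounts for at most two tips.\<close>

lemma card_tips_diff_unselected_le:
  assumes "\<And>m. 1 \<le> m \<Longrightarrow> \<theta> m \<le> K" "1 \<le> n"
  shows "card (tips \<theta> x y (int n - int j) - unselected x y n) \<le> 2 * (K + j)"
proof -
  \<comment> \<open>This window has at most \<open>K + j\<close> elements, also when the natural
    subtraction truncates to 0.\<close>
  let ?S = "{n - j - K..<n}"
  have "tips \<theta> x y (int n - int j) - unselected x y n \<subseteq> x ` ?S \<union> y ` ?S"
  proof
    fix v assume v: "v \<in> tips \<theta> x y (int n - int j) - unselected x y n"
    then have "v < n" using tips_less[of v] assms(2) by blast
    with v obtain m where m: "1 \<le> m" "m < n" "v = x m \<or> v = y m"
      by (auto simp: unselected_def)
    \<comment> \<open>Otherwise the edge from \<open>m\<close> to \<open>v\<close> would already be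
      present and \<open>v\<close> would not be a tip.\<close>
    then have "nat (int n - int j) \<le> m + \<theta> m"
      using v by (force simp: tips_def edges_iff)
    with assms(1)[OF m(1)] m(2) have "m \<in> ?S" by auto
    with m(3) show "v \<in> x ` ?S \<union> y ` ?S" by blast
  qed
  then have "card (tips \<theta> x y (int n - int j) - unselected x y n) \<le> card (x ` ?S \<union> y ` ?S)"
    by (intro card_mono) auto
  also have "\<dots> \<le> card (x ` ?S) + card (y ` ?S)" by (rule card_Un_le)
  also have "\<dots> \<le> card ?S + card ?S" by (intro add_mono card_image_le) auto
  also have "\<dots> \<le> 2 * (K + j)" by simp
  finally show ?thesis .
qed

section \<open>Averages over pairs of parents\<close>

text \<open>Each coordinate contributes \<open>card T * card (T \<inter> F)\<close>; the diagonal
  pairs, where both parents coincide, are counted twice and are corrected by one copy of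
  \<open>card (T \<inter> F)\<close>.\<close>

lemma sum_card_pair_Int:
  assumes "finite T"
  shows "(\<Sum>v\<in>T. \<Sum>v'\<in>T. real (card ({v, v'} \<inter> F)))
    = real (card (T \<inter> F)) * (2 * real (card T) - 1)"
proof -
  have *: "real (card ({v, v'} \<inter> F))
    = indicator F v + indicator F v' - (if v' = v then indicator F v else 0)" for v v'
    by (auto simp: insert_absorb Int_insert_left split: split_indicator)
  have ind: "(\<Sum>v\<in>T. indicator F v) = real (card (T \<inter> F))"
    using assms by (simp add: indicator_def sum.If_cases)
  show ?thesis
    using assms
    by (simp add: * ind sum.distrib sum_subtractf sum.delta algebra_simps
        flip: sum_distrib_left sum_distrib_right)
qed

text \<open>With \<open>L = card T\<close> the mean is at least
  \<open>(L - c) * (2 * L - 1) / L^2 = 2 - (2 * c + 1) / L + c / L^2\<close>, and the last term is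
  dropped. The bound is split as 1 plus a rest: the 1 will offset the arriving vertex, the rest is
  the drift.\<close>

lemma mean_card_pair_Int_ge:
  assumes "finite T" "real (card (T - F)) \<le> c" "1 < b" "b < real (card T)"
  shows "1 + (1 - (2 * c + 1) / b)
    \<le> (\<Sum>v\<in>T. \<Sum>v'\<in>T. real (card ({v, v'} \<inter> F))) / (real (card T))\<^sup>2"
proof -
  let ?L = "real (card T)"
  have c0: "0 \<le> c" using assms(2) by linarith
  have L: "1 < ?L" using assms by linarith
  have "real (card T) = real (card (T \<inter> F)) + real (card (T - F))"
    using card_Int_Diff[OF assms(1), of F] by simp
  then have f: "?L - c \<le> real (card (T \<inter> F))" using assms(2) by linarith
  have "(2 * c + 1) / ?L \<le> (2 * c + 1) / b"
    using assms c0 by (intro divide_left_mono) auto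
  then have "1 + (1 - (2 * c + 1) / b) \<le> 2 - (2 * c + 1) / ?L" by linarith
  also have "\<dots> = (2 * ?L\<^sup>2 - (2 * c + 1) * ?L) / ?L\<^sup>2"
    using L by (simp add: field_simps power2_eq_square)
  also have "\<dots> \<le> ((?L - c) * (2 * ?L - 1)) / ?L\<^sup>2"
    using c0 by (intro divide_right_mono) (auto simp: algebra_simps power2_eq_square)
  also have "\<dots> \<le> (real (card (T \<inter> F)) * (2 * ?L - 1)) / ?L\<^sup>2"
    using f L by (intro divide_right_mono mult_right_mono) auto
  finally show ?thesis by (simp add: sum_card_pair_Int[OF assms(1)])
qed

section \<open>Measurability with respect to the history\<close>

context tip_model
begin

abbreviation "Hist \<equiv> history P \<Theta> lag X Y"

abbreviation "tip_set \<equiv> tips_at \<Theta> X Y"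

abbreviation "tip_count \<equiv> num_tips_at \<Theta> X Y"

abbreviation "free \<omega> n \<equiv> unselected (\<lambda>m. X m \<omega>) (\<lambda>m. Y m \<omega>) n"

lemma space_history [simp]: "space (Hist n) = space P"
  by (simp add: history_def space_measure_of_conv)

lemma sets_history:
  "sets (Hist n) = sigma_sets (space P)
    {Z -` B \<inter> space P | Z B. \<exists>m\<in>{1..n}. Z \<in> {\<Theta> m, lag m, X m, Y m}}"
  unfolding history_def by (rule sets_measure_of) auto

lemma subalgebra_history: "subalgebra P (Hist n)"
  unfolding subalgebra_def sets_history
proof (intro conjI sets.sigma_sets_subset subsetI)
  fix A assume "A \<in> {Z -` B \<inter> space P | Z B. \<exists>m\<in>{1..n}. Z \<in> {\<Theta> m, lag m, X m, Y m}}"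
  then obtain Z B m where A: "A = Z -` B \<inter> space P" "1 \<le> m" "Z \<in> {\<Theta> m, lag m, X m, Y m}"
    by auto
  then have "Z \<in> measurable P (count_space UNIV)"
    using measurable_\<Theta>[of m] measurable_lag[of m] measurable_X[of m] measurable_Y[of m] by auto
  then show "A \<in> sets P" unfolding A(1) by (rule measurable_sets) simp
qed simp

text \<open>The variables up to \<open>n\<close> form a vector with values in a countable type. A
  function determined by this vector has preimages that are countable unions of its fibres, whatever
  the target space \<open>N\<close>.\<close>

lemma history_measurableI:
  assumes "\<And>\<omega>. \<omega> \<in> space P \<Longrightarrow> f \<omega> \<in> space N"
    and "\<And>\<omega> \<omega>'. \<omega> \<in> space P \<Longrightarrow> \<omega>' \<in> space P \<Longrightarrow>
      (\<And>m. 1 \<le> m \<Longrightarrow> m \<le> n \<Longrightarrow> \<Theta> m \<omega> = \<Theta> m \<omega>' \<and> X m \<omega> = X m \<omega>' \<and> Y m \<omega> = Y m \<omega>') \<Longrightarrow>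
      f \<omega> = f \<omega>'"
  shows "f \<in> measurable (Hist n) N"
proof (rule measurableI)
  fix A assume "A \<in> sets N"
  \<comment> \<open>Lags are left out because the graphs depend on them only through the chosen
    parents.\<close>
  define Z where "Z \<omega> = map (\<lambda>m. (\<Theta> m \<omega>, X m \<omega>, Y m \<omega>)) [1..<Suc n]" for \<omega>
  have Z_eq: "Z \<omega> = Z \<omega>' \<longleftrightarrow>
    (\<forall>m\<in>{1..n}. \<Theta> m \<omega> = \<Theta> m \<omega>' \<and> X m \<omega> = X m \<omega>' \<and> Y m \<omega> = Y m \<omega>')" for \<omega> \<omega>'
    unfolding Z_def map_eq_conv by (auto simp del: upt_Suc)
  have gen: "W -` B \<inter> space P \<in> sets (Hist n)"
    if "m \<in> {1..n}" "W \<in> {\<Theta> m, X m, Y m}" for W m B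
    unfolding sets_history using that by (intro sigma_sets.Basic) blast
  have fibre: "{\<omega>' \<in> space (Hist n). Z \<omega>' = Z \<omega>} \<in> sets (Hist n)" for \<omega>
    unfolding Z_eq
  proof (rule sets.sets_Collect_finite_All)
    fix m assume m: "m \<in> {1..n}"
    show "{\<omega>' \<in> space (Hist n).
        \<Theta> m \<omega>' = \<Theta> m \<omega> \<and> X m \<omega>' = X m \<omega> \<and> Y m \<omega>' = Y m \<omega>} \<in> sets (Hist n)"
    proof -
      have "{\<omega>' \<in> space (Hist n). \<Theta> m \<omega>' = \<Theta> m \<omega> \<and> X m \<omega>' = X m \<omega> \<and> Y m \<omega>' = Y m \<omega>}
        = (\<Theta> m -` {\<Theta> m \<omega>} \<inter> space P) \<inter> ((X m -` {X m \<omega>} \<inter> space P) \<inter> (Y m -` {Y m \<omega>} \<inter> space P))"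
        by auto
      then show ?thesis using gen[OF m] by (auto intro!: sets.Int)
    qed
  qed auto
  let ?S = "f -` A \<inter> space P"
  have "f -` A \<inter> space (Hist n)
    = (\<Union>z\<in>Z ` ?S. {\<omega>' \<in> space (Hist n). Z \<omega>' = z})"
  proof (intro set_eqI iffI)
    fix \<omega> assume "\<omega> \<in> (\<Union>z\<in>Z ` ?S. {\<omega>' \<in> space (Hist n). Z \<omega>' = z})"
    then obtain \<omega>' where "\<omega>' \<in> ?S" "\<omega> \<in> space P" "Z \<omega> = Z \<omega>'" by auto
    moreover from this have "f \<omega> = f \<omega>'" unfolding Z_eq by (intro assms(2)) auto
    ultimately show "\<omega> \<in> f -` A \<inter> space (Hist n)" by simp
  qed auto
  also have "\<dots> \<in> sets (Hist n)"
    using fibre by (intro sets.countable_UN') auto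
  finally show "f -` A \<inter> space (Hist n) \<in> sets (Hist n)" .
qed (use assms(1) in simp)

lemma POW_le: "1 \<le> m \<Longrightarrow> \<omega> \<in> space P \<Longrightarrow> \<Theta> m \<omega> \<le> h M"
  using \<Theta>_range[of m \<omega>] strict_mono_on_leD[OF h_strict_mono, of _ M] by auto

lemma free_history_cong:
  assumes "\<And>m. 1 \<le> m \<Longrightarrow> m \<le> n - 1 \<Longrightarrow> \<Theta> m \<omega> = \<Theta> m \<omega>' \<and> X m \<omega> = X m \<omega>' \<and> Y m \<omega> = Y m \<omega>'"
  shows "free \<omega> n = free \<omega>' n"
proof -
  have "X m \<omega> = X m \<omega>' \<and> Y m \<omega> = Y m \<omega>'" if "m \<in> {1..<n}" for m
    using assms[of m] that by auto
  then show ?thesis by (auto simp: unselected_def)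
qed

lemma free_measurable:
  "(\<lambda>\<omega>. real (card (A \<inter> free \<omega> n))) \<in> borel_measurable (Hist (n - 1))"
proof (rule history_measurableI)
  fix \<omega> \<omega>'
  assume "\<And>m. 1 \<le> m \<Longrightarrow> m \<le> n - 1 \<Longrightarrow>
    \<Theta> m \<omega> = \<Theta> m \<omega>' \<and> X m \<omega> = X m \<omega>' \<and> Y m \<omega> = Y m \<omega>'"
  then have "free \<omega> n = free \<omega>' n" by (rule free_history_cong)
  then show "real (card (A \<inter> free \<omega> n)) = real (card (A \<inter> free \<omega>' n))" by simp
qed simp

lemma many_tips_measurable:
  "{\<omega> \<in> space P. \<forall>i\<in>{n0..n}. b < real (tip_count \<omega> (int i))} \<in> sets (Hist n)"
proof -
  have "(\<lambda>\<omega>. \<forall>i\<in>{n0..n}. b < real (tip_count \<omega> (int i)))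
    \<in> measurable (Hist n) (count_space UNIV)"
  proof (rule history_measurableI)
    fix \<omega> \<omega>'
    assume "\<And>m. 1 \<le> m \<Longrightarrow> m \<le> n \<Longrightarrow>
      \<Theta> m \<omega> = \<Theta> m \<omega>' \<and> X m \<omega> = X m \<omega>' \<and> Y m \<omega> = Y m \<omega>'"
    then have "tip_count \<omega> (int i) = tip_count \<omega>' (int i)" if "i \<in> {n0..n}" for i
      unfolding num_tips_at_def num_tips_def
      using that by (intro arg_cong[where f = card] tips_cong) auto
    then show "(\<forall>i\<in>{n0..n}. b < real (tip_count \<omega> (int i)))
      = (\<forall>i\<in>{n0..n}. b < real (tip_count \<omega>' (int i)))"
      by auto
  qed simp
  from predE[OF this] show ?thesis unfolding space_history .
qed

section \<open>Drift of the number of unselected vertices\<close>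

text \<open>The event \<open>H\<close> is known before \<open>n\<close> arrives and guarantees more
  than \<open>b\<close> tips for every possible lag. The conditional law then makes \<open>n\<close>
  select on average at least \<open>1 + \<delta>\<close> unselected vertices, while its arrival adds
  at most one. The constant is \<open>2 * c + 1\<close> for
  \<open>c = 2 * (h M + Max I)\<close>.\<close>

lemma expected_free_Suc_le:
  assumes "1 \<le> n" "1 < b" and H: "H \<in> sets (Hist (n - 1))"
    and tips: "\<And>\<omega> j. \<omega> \<in> H \<Longrightarrow> j \<in> I \<Longrightarrow> b < real (tip_count \<omega> (int n - int j))"
  shows "(\<integral>\<omega>. indicator H \<omega> * real (card (free \<omega> (Suc n))) \<partial>P)
    \<le> (\<integral>\<omega>. indicator H \<omega> * real (card (free \<omega> n)) \<partial>P)
      - (1 - (4 * (real (h M) + real (Max I)) + 1) / b) * prob H"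
proof -
  define \<delta> where "\<delta> = 1 - (4 * (real (h M) + real (Max I)) + 1) / b"
  let ?F = "Hist (n - 1)"
  interpret finite_measure_subalgebra P ?F
    by (intro finite_measure_subalgebra.intro finite_measure_subalgebra_axioms.intro
        subalgebra_history finite_measure_axioms)
  \<comment> \<open>Finitely many outcomes suffice, as tips at times before \<open>n\<close> are
    vertices below \<open>n\<close>. For an outcome \<open>s\<close>, \<open>W s\<close> is the
    number of unselected vertices it would select on \<open>H\<close>; it depends on the history
    only, and \<open>E s\<close> is the event that \<open>s\<close> occurs.\<close>
  define S where "S = {1..M} \<times> I \<times> {..<n} \<times> {..<n}"
  define W where "W s \<omega> = (case s of (k, j, v, v') \<Rightarrow>
    indicator H \<omega> * real (card ({v, v'} \<inter> free \<omega> n)))"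
    for s :: "nat \<times> nat \<times> nat \<times> nat" and \<omega>
  define E where "E s = (case s of (k, j, v, v') \<Rightarrow>
    {\<omega> \<in> space P. \<Theta> n \<omega> = h k \<and> lag n \<omega> = j \<and> X n \<omega> = v \<and> Y n \<omega> = v'})"
    for s :: "nat \<times> nat \<times> nat \<times> nat"
  have [simp]: "finite S" using I_finite by (simp add: S_def)
  have [measurable]: "H \<in> sets P" using H subalgebra_history by (auto simp: subalgebra_def)
  have HP: "\<omega> \<in> space P" if "\<omega> \<in> H" for \<omega>
    using that \<open>H \<in> sets P\<close> sets.sets_into_space by blast
  have [measurable]: "(\<lambda>\<omega>. real (card (free \<omega> m))) \<in> borel_measurable P" for m
    using measurable_from_subalg[OF subalgebra_history free_measurable[of UNIV m]] by simp
  have W_meas: "W s \<in> borel_measurable ?F" for s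
  proof (cases s)
    case (fields k j v v')
    show ?thesis
      unfolding W_def fields prod.case
      by (intro borel_measurable_times borel_measurable_indicator free_measurable H)
  qed
  have [measurable]: "W s \<in> borel_measurable P" for s
    by (rule measurable_from_subalg[OF subalgebra_history W_meas])
  have E_meas [measurable]: "E s \<in> sets P" for s
  proof -
    note [measurable] = measurable_\<Theta>[OF assms(1)] measurable_lag[OF assms(1)]
      measurable_X[OF assms(1)] measurable_Y[OF assms(1)]
    show ?thesis unfolding E_def by (cases s) simp
  qed
  have W_bound: "norm (W s \<omega>) \<le> 2" for s \<omega>
  proof -
    obtain k j v v' where s: "s = (k, j, v, v')" by (cases s)
    have "card ({v, v'} \<inter> free \<omega> n) \<le> card {v, v'}" by (intro card_mono) auto
    also have "\<dots> \<le> 2" by (simp add: card_insert_if)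
    finally show ?thesis by (auto simp: W_def s split: split_indicator)
  qed
  have WE_int: "integrable P (\<lambda>\<omega>. W s \<omega> * indicator (E s) \<omega>)" for s
    using W_bound by (intro integrable_const_bound[where B = 2])
      (auto intro!: AE_I2 simp: mult_le_one split: split_indicator)
  have free_int: "integrable P (\<lambda>\<omega>. indicator H \<omega> * real (card (free \<omega> m)))" for m
    using card_unselected_le
    by (intro integrable_const_bound[where B = "real m"]) (auto split: split_indicator)
  have H_int: "integrable P (indicat_real H)"
    by (intro integrable_real_indicator) (auto simp: less_top[symmetric])
  have sum_int: "integrable P (\<lambda>\<omega>. \<Sum>s\<in>S. W s \<omega> * indicator (E s) \<omega>)"
    by (intro Bochner_Integration.integrable_sum WE_int)
  \<comment> \<open>Since \<open>h\<close> is injective, at most one event \<open>E s\<close>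
    contains \<omega>. The actual outcome may lie outside \<open>S\<close> on some paths, hence only
    an inequality.\<close>
  have selected: "(\<Sum>s\<in>S. W s \<omega> * indicator (E s) \<omega>)
    \<le> indicator H \<omega> * real (card ({X n \<omega>, Y n \<omega>} \<inter> free \<omega> n))" if \<omega>: "\<omega> \<in> space P" for \<omega>
  proof -
    obtain k where k: "k \<in> {1..M}" "\<Theta> n \<omega> = h k" using \<Theta>_range[OF assms(1) \<omega>] by auto
    define s0 where "s0 = (k, lag n \<omega>, X n \<omega>, Y n \<omega>)"
    have "W s \<omega> * indicator (E s) \<omega> = (if s = s0 then W s0 \<omega> else 0)" if "s \<in> S" for s
      using that k \<omega> strict_mono_on_imp_inj_on[OF h_strict_mono]
      by (auto simp: S_def E_def s0_def inj_on_eq_iff split: split_indicator)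
    then have "(\<Sum>s\<in>S. W s \<omega> * indicator (E s) \<omega>) = (if s0 \<in> S then W s0 \<omega> else 0)"
      by simp
    also have "\<dots> \<le> W s0 \<omega>" by (auto simp: W_def s0_def)
    finally show ?thesis by (simp add: W_def s0_def)
  qed
  have law_S: "AE \<omega> in P. \<forall>s\<in>S. real_cond_exp P ?F (indicator (E s)) \<omega> = (case s of (k, j, v, v') \<Rightarrow>
      p\<Theta> k * plag j / (real (tip_count \<omega> (int n - int j)))\<^sup>2
      * (if v \<in> tip_set \<omega> (int n - int j) \<and> v' \<in> tip_set \<omega> (int n - int j) then 1 else 0))"
  proof (rule AE_finite_allI[OF \<open>finite S\<close>])
    fix s assume "s \<in> S"
    then obtain k j v v' where s: "s = (k, j, v, v')" "k \<in> {1..M}" "j \<in> I"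
      by (auto simp: S_def)
    show "AE \<omega> in P. real_cond_exp P ?F (indicator (E s)) \<omega> = (case s of (k, j, v, v') \<Rightarrow>
      p\<Theta> k * plag j / (real (tip_count \<omega> (int n - int j)))\<^sup>2
      * (if v \<in> tip_set \<omega> (int n - int j) \<and> v' \<in> tip_set \<omega> (int n - int j) then 1 else 0))"
      unfolding s(1) E_def prod.case by (rule law[OF assms(1) s(2,3)])
  qed
  \<comment> \<open>Inserting the law turns the right side into an average over POW, lag and pairs
    of tips; the pair average is bounded below for each lag separately.\<close>
  have drift: "AE \<omega> in P. (1 + \<delta>) * indicator H \<omega>
    \<le> (\<Sum>s\<in>S. W s \<omega> * real_cond_exp P ?F (indicator (E s)) \<omega>)"
    using law_S
  proof eventually_elim
    case (elim \<omega>)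
    show ?case
    proof (cases "\<omega> \<in> H")
      case False
      then show ?thesis by (simp add: W_def case_prod_unfold)
    next
      case True
      define w where "w v v' = real (card ({v, v'} \<inter> free \<omega> n))" for v v'
      define T where "T j = tip_set \<omega> (int n - int j)" for j
      have T: "finite (T j)" "T j \<subseteq> {..<n}" "real (card (T j)) = real (tip_count \<omega> (int n - int j))" for j
        using tips_less[OF _ assms(1)]
        by (auto simp: T_def tips_at_def num_tips_at_def num_tips_def finite_tips)
      have T_ge: "1 + \<delta> \<le> (\<Sum>v\<in>T j. \<Sum>v'\<in>T j. w v v') / (real (card (T j)))\<^sup>2" if "j \<in> I" for j
      proof -
        have "card (T j - free \<omega> n) \<le> 2 * (h M + j)"
          unfolding T_def tips_at_def
          using POW_le[OF _ HP[OF True]] assms(1) by (intro card_tips_diff_unselected_le) auto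
        also have "\<dots> \<le> 2 * (h M + Max I)" using that I_finite by simp
        finally have "real (card (T j - free \<omega> n)) \<le> 2 * (real (h M) + real (Max I))"
          using of_nat_mono by fastforce
        from mean_card_pair_Int_ge[OF T(1) this \<open>1 < b\<close>] tips[OF True that]
        show ?thesis by (simp add: T(3) w_def \<delta>_def)
      qed
      \<comment> \<open>The POW and lag weights sum to 1, so the constant can be distributed over
        them.\<close>
      have "(1 + \<delta>) = (\<Sum>k=1..M. p\<Theta> k) * ((\<Sum>j\<in>I. plag j) * (1 + \<delta>))"
        unfolding p\<Theta>_sum plag_sum by simp
      also have "\<dots> = (\<Sum>k=1..M. \<Sum>j\<in>I. p\<Theta> k * plag j * (1 + \<delta>))"
        by (simp only: sum_distrib_right[of plag] sum_product mult.assoc)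
      also have "\<dots> \<le> (\<Sum>k=1..M. \<Sum>j\<in>I. p\<Theta> k * plag j *
          ((\<Sum>v\<in>T j. \<Sum>v'\<in>T j. w v v') / (real (card (T j)))\<^sup>2))"
        using T_ge p\<Theta>_pos plag_pos
        by (intro sum_mono mult_left_mono) (auto intro: less_imp_le)
      also have "\<dots> = (\<Sum>k=1..M. \<Sum>j\<in>I. \<Sum>v<n. \<Sum>v'<n. w v v' *
          (p\<Theta> k * plag j / (real (card (T j)))\<^sup>2 * (if v \<in> T j \<and> v' \<in> T j then 1 else 0)))"
      proof (intro sum.cong refl)
        fix k j
        have "(\<Sum>v\<in>T j. \<Sum>v'\<in>T j. w v v')
          = (\<Sum>v<n. \<Sum>v'<n. w v v' * (if v \<in> T j \<and> v' \<in> T j then 1 else 0))"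
          \<comment> \<open>All tips are below \<open>n\<close>, and pairs not consisting of tips
            contribute 0.\<close>
          unfolding sum.cartesian_product using T(1,2)[of j]
          by (intro sum.mono_neutral_cong_left) (auto split: if_splits)
        then have "p\<Theta> k * plag j * ((\<Sum>v\<in>T j. \<Sum>v'\<in>T j. w v v') / (real (card (T j)))\<^sup>2)
          = p\<Theta> k * plag j / (real (card (T j)))\<^sup>2
            * (\<Sum>v<n. \<Sum>v'<n. w v v' * (if v \<in> T j \<and> v' \<in> T j then 1 else 0))"
          by (simp only: times_divide_eq_right times_divide_eq_left)
        also have "\<dots> = (\<Sum>v<n. \<Sum>v'<n. w v v' *
          (p\<Theta> k * plag j / (real (card (T j)))\<^sup>2 * (if v \<in> T j \<and> v' \<in> T j then 1 else 0)))"
          unfolding sum_distrib_left by (simp only: mult.left_commute)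
        finally show "p\<Theta> k * plag j * ((\<Sum>v\<in>T j. \<Sum>v'\<in>T j. w v v') / (real (card (T j)))\<^sup>2)
          = (\<Sum>v<n. \<Sum>v'<n. w v v' *
          (p\<Theta> k * plag j / (real (card (T j)))\<^sup>2 * (if v \<in> T j \<and> v' \<in> T j then 1 else 0)))" .
      qed
      also have "\<dots> = (\<Sum>s\<in>S. W s \<omega> * real_cond_exp P ?F (indicator (E s)) \<omega>)"
        unfolding S_def sum.cartesian_product
      proof (intro sum.cong refl)
        fix s assume "s \<in> {1..M} \<times> I \<times> {..<n} \<times> {..<n}"
        then have "s \<in> S" by (simp only: S_def)
        obtain k j v v' where s: "s = (k, j, v, v')" by (cases s)
        have "real_cond_exp P ?F (indicator (E s)) \<omega> = p\<Theta> k * plag j / (real (card (T j)))\<^sup>2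
            * (if v \<in> T j \<and> v' \<in> T j then 1 else 0)"
          using bspec[OF elim \<open>s \<in> S\<close>] unfolding s prod.case T(3) unfolding T_def .
        moreover have "W s \<omega> = w v v'" using True by (simp add: s W_def w_def)
        ultimately show "(case s of (k, j, v, v') \<Rightarrow> w v v' *
            (p\<Theta> k * plag j / (real (card (T j)))\<^sup>2 * (if v \<in> T j \<and> v' \<in> T j then 1 else 0)))
          = W s \<omega> * real_cond_exp P ?F (indicator (E s)) \<omega>"
          by (simp only: s prod.case)
      qed
      finally show ?thesis using True by simp
    qed
  qed
  \<comment> \<open>As \<open>W s\<close> is history-measurable, the conditional probability of
    \<open>E s\<close> may be replaced by its indicator under the integral.\<close>
  note W_cond = real_cond_exp_intg[OF WE_int W_meas borel_measurable_indicator[OF E_meas]]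
  have "(1 + \<delta>) * prob H = (\<integral>\<omega>. (1 + \<delta>) * indicator H \<omega> \<partial>P)"
    by simp
  also have "\<dots> \<le> (\<integral>\<omega>. (\<Sum>s\<in>S. W s \<omega> * real_cond_exp P ?F (indicator (E s)) \<omega>) \<partial>P)"
  proof (rule integral_mono_AE)
    show "integrable P (\<lambda>\<omega>. \<Sum>s\<in>S. W s \<omega> * real_cond_exp P ?F (indicator (E s)) \<omega>)"
      by (intro Bochner_Integration.integrable_sum W_cond)
  qed (use drift H_int in auto)
  also have "\<dots> = (\<integral>\<omega>. (\<Sum>s\<in>S. W s \<omega> * indicator (E s) \<omega>) \<partial>P)"
    using W_cond WE_int
    by (simp add: Bochner_Integration.integral_sum del: sum_mult_indicator)
  finally have gain: "(1 + \<delta>) * prob H \<le> (\<integral>\<omega>. (\<Sum>s\<in>S. W s \<omega> * indicator (E s) \<omega>) \<partial>P)" .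
  have "(\<integral>\<omega>. indicator H \<omega> * real (card (free \<omega> (Suc n))) \<partial>P)
    \<le> (\<integral>\<omega>. indicator H \<omega> * real (card (free \<omega> n)) + indicator H \<omega>
        - (\<Sum>s\<in>S. W s \<omega> * indicator (E s) \<omega>) \<partial>P)"
  proof (rule integral_mono)
    fix \<omega> assume \<omega>: "\<omega> \<in> space P"
    have "real (card (free \<omega> (Suc n))) + real (card ({X n \<omega>, Y n \<omega>} \<inter> free \<omega> n))
      \<le> real (card (free \<omega> n)) + 1"
      using card_unselected_Suc[OF assms(1), of "\<lambda>m. X m \<omega>" "\<lambda>m. Y m \<omega>"] by linarith
    with selected[OF \<omega>]
    show "indicator H \<omega> * real (card (free \<omega> (Suc n)))
      \<le> indicator H \<omega> * real (card (free \<omega> n)) + indicator H \<omega>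
        - (\<Sum>s\<in>S. W s \<omega> * indicator (E s) \<omega>)"
      by (cases "\<omega> \<in> H") auto
  qed (intro Bochner_Integration.integrable_diff Bochner_Integration.integrable_add free_int H_int sum_int)+
  also have "\<dots> = (\<integral>\<omega>. indicator H \<omega> * real (card (free \<omega> n)) \<partial>P) + prob H
      - (\<integral>\<omega>. (\<Sum>s\<in>S. W s \<omega> * indicator (E s) \<omega>) \<partial>P)"
    using free_int H_int sum_int by (simp del: sum_mult_indicator)
  finally show ?thesis using gain unfolding \<delta>_def[symmetric] by (simp add: algebra_simps)
qed

section \<open>Almost sure return to low tip counts\<close>

text \<open>If all counts from \<open>n0\<close> on exceeded \<open>b\<close> with probability
  \<open>q > 0\<close>, the expectations \<open>a n\<close> would fall by at least
  \<open>\<delta> * q\<close> per step forever, although they are nonnegative.\<close>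

lemma AE_not_eventually_many_tips:
  assumes b: "4 * (real (h M) + real (Max I)) + 1 < b"
  shows "AE \<omega> in P. \<exists>i\<ge>n0. real (tip_count \<omega> (int i)) \<le> b"
proof -
  define \<delta> where "\<delta> = 1 - (4 * (real (h M) + real (Max I)) + 1) / b"
  have "0 < real (h M)" using strict_mono_on_leD[OF h_strict_mono, of 1 M] h_pos M_ge_2 by simp
  then have "1 < b" using b of_nat_0_le_iff[of "Max I", where 'a = real] by argo
  with b have "0 < \<delta>" by (simp add: \<delta>_def)
  \<comment> \<open>The event is truncated at time \<open>n\<close> to stay in the history; the
    intersection over \<open>n\<close> is the bad event. In \<open>a n\<close> the index
    \<open>n - 1\<close> is used because the law of vertex \<open>n\<close> is conditional on that
    history.\<close>
  define G where "G n = {\<omega> \<in> space P. \<forall>i\<in>{n0..n}. b < real (tip_count \<omega> (int i))}" for n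
  define q where "q = prob (\<Inter>n. G n)"
  define a where "a n = (\<integral>\<omega>. indicator (G (n - 1)) \<omega> * real (card (free \<omega> n)) \<partial>P)" for n
  \<comment> \<open>From \<open>N\<close> on, every time \<open>n - j\<close> with
    \<open>j \<in> I\<close> lies in \<open>{n0..n - 1}\<close>, where \<open>G (n - 1)\<close>
    controls the tip count.\<close>
  define N where "N = n0 + Max I + 1"
  have G_hist: "G n \<in> sets (Hist n)" for n
    unfolding G_def by (rule many_tips_measurable)
  then have G_meas [measurable]: "G n \<in> sets P" for n
    using subalgebra_history by (auto simp: subalgebra_def)
  have [measurable]: "(\<lambda>\<omega>. real (card (free \<omega> m))) \<in> borel_measurable P" for m
    using measurable_from_subalg[OF subalgebra_history free_measurable[of UNIV m]] by simp
  have free_int: "integrable P (\<lambda>\<omega>. indicator (G k) \<omega> * real (card (free \<omega> m)))" for k m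
    using card_unselected_le
    by (intro integrable_const_bound[where B = "real m"]) (auto split: split_indicator)
  have step: "a (Suc n) \<le> a n - \<delta> * q" if "N \<le> n" for n
  proof -
    \<comment> \<open>\<open>G n\<close> is contained in \<open>G (n - 1)\<close> and the integrand
      is nonnegative, so the indicator may be enlarged.\<close>
    have "a (Suc n) \<le> (\<integral>\<omega>. indicator (G (n - 1)) \<omega> * real (card (free \<omega> (Suc n))) \<partial>P)"
      unfolding a_def by (intro integral_mono free_int mult_right_mono)
        (auto simp: G_def split: split_indicator)
    also have "\<dots> \<le> a n - \<delta> * prob (G (n - 1))"
      unfolding a_def \<delta>_def
    proof (rule expected_free_Suc_le)
      fix \<omega> j assume "\<omega> \<in> G (n - 1)" "j \<in> I"
      moreover from this have "j \<le> Max I" "0 < j" using I_finite I_pos by auto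
      moreover from this that have "n - j \<in> {n0..n - 1}" by (auto simp: N_def)
      ultimately have "b < real (tip_count \<omega> (int (n - j)))"
        unfolding G_def by blast
      then show "b < real (tip_count \<omega> (int n - int j))"
        using \<open>j \<le> Max I\<close> that by (simp add: N_def of_nat_diff)
    qed (use that \<open>1 < b\<close> G_hist in \<open>auto simp: N_def\<close>)
    also have "\<dots> \<le> a n - \<delta> * q"
      using \<open>0 < \<delta>\<close> unfolding q_def
      by (intro diff_left_mono mult_left_mono finite_measure_mono) auto
    finally show ?thesis .
  qed
  have iter: "a (N + k) \<le> a N - real k * (\<delta> * q)" for k
  proof (induction k)
    case (Suc k)
    with step[of "N + k"] show ?case by (simp add: algebra_simps)
  qed simp
  have a_nonneg: "0 \<le> a n" for n unfolding a_def by (intro integral_nonneg_AE) auto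
  have "q = 0"
  proof (rule ccontr)
    assume "q \<noteq> 0"
    then have "0 < \<delta> * q" using \<open>0 < \<delta>\<close> by (simp add: q_def zero_less_measure_iff)
    then obtain k where "a N < real k * (\<delta> * q)" using reals_Archimedean3 by blast
    with iter[of k] a_nonneg[of "N + k"] show False by linarith
  qed
  then have "(\<Inter>n. G n) \<in> null_sets P"
    by (intro null_setsI) (auto simp: q_def emeasure_eq_measure)
  from AE_not_in[OF this] AE_space show ?thesis
  proof eventually_elim
    case (elim \<omega>)
    then obtain n where "\<omega> \<notin> G n" by blast
    with elim(2) show ?case by (auto simp: G_def not_less)
  qed
qed

end

theorem lemma3p6:
  fixes P :: "'a measure"
    and M :: nat
    and h :: "nat \<Rightarrow> nat"
    and p\<Theta> plag :: "nat \<Rightarrow> real"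
    and I :: "nat set"
    and \<Theta> lag X Y :: "nat \<Rightarrow> 'a \<Rightarrow> nat"
    and b :: real
    and A :: "nat \<Rightarrow> 'a set"
  assumes "tip_model P M h p\<Theta> I plag \<Theta> lag X Y"
    and "b > 10 * real (h M) - 6 * real (h 1) + 3 * real M * real (Max I) + 2"
    and "\<And>i. i \<ge> 1 \<Longrightarrow> A i = {\<omega> \<in> space P. real (num_tips_at \<Theta> X Y \<omega> (int i)) \<le> b}"
  shows "AE \<omega> in P. infinite {i. i \<ge> 1 \<and> \<omega> \<in> A i}"
proof -
  interpret tip_model P M h p\<Theta> I plag \<Theta> lag X Y by (fact assms(1))
  \<comment> \<open>Write \<open>10 * h M - 6 * h 1 = 4 * h M + 6 * (h M - h 1)\<close>; with
    \<open>M \<ge> 2\<close> the given threshold exceeds the drift threshold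
    \<open>4 * (h M + Max I) + 1\<close>.\<close>
  have "real (h 1) < real (h M)"
    using strict_mono_onD[OF h_strict_mono, of 1 M] M_ge_2 by simp
  moreover have "6 * real (Max I) \<le> 3 * real M * real (Max I)"
    using M_ge_2 by (intro mult_right_mono) auto
  ultimately have b: "4 * (real (h M) + real (Max I)) + 1 < b"
    using assms(2) of_nat_0_le_iff[of "Max I", where 'a = real] by (simp add: algebra_simps)
  have "AE \<omega> in P. \<forall>n0. \<exists>i\<ge>n0. real (tip_count \<omega> (int i)) \<le> b"
    unfolding AE_all_countable using AE_not_eventually_many_tips[OF b] by blast
  then show ?thesis
  proof (rule AE_mp, intro AE_I2 impI)
    fix \<omega> assume "\<omega> \<in> space P" and low: "\<forall>n0. \<exists>i\<ge>n0. real (tip_count \<omega> (int i)) \<le> b"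
    show "infinite {i. i \<ge> 1 \<and> \<omega> \<in> A i}"
      unfolding infinite_nat_iff_unbounded
    proof
      fix m
      obtain i where "i \<ge> Suc m" "real (tip_count \<omega> (int i)) \<le> b" using low by blast
      with assms(3)[of i] \<open>\<omega> \<in> space P\<close> show "\<exists>n>m. n \<in> {i. i \<ge> 1 \<and> \<omega> \<in> A i}"
        by (intro exI[of _ i]) auto
    qed
  qed
qed

end
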